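(* Let $K$ be a field, let $S = K[X_1,\ldots,X_n]$, and let $I\subset S$ be a monomial ideal with linear quotients with respect to the order $u_1,\ldots,u_r$ of its minimal set of monomial generators. Then the Taylor resolution of $I$ is minimal if and only if $\vert \mathrm{set}(u_i)\vert = i-1$ for all $i=1,\ldots,r$.
   Context: For a monomial ideal $I\subset S=K[X_1,\ldots,X_n]$, let $G(I)=\{u_1,\ldots,u_r\}$ be its minimal set of monomial generators. The Taylor resolution $(T_\bullet(I),d_\bullet)$ of $I$: let $L$ be the free $S$-module with basis $e_1,\ldots,e_r$; set $T_q(I)=\bigwedge^{q+1}L$ for $q=0,\ldots,r-1$; for $q=1,\ldots,r-1$ the map $d_q:T_q(I)\to T_{q-1}(I)$ is $$d_q(e_{i_0}\wedge\cdots\wedge e_{i_q})=\sum_{s=0}^{q}(-1)^s\frac{\mathrm{lcm}(u_{i_0},\ldots,u_{i_q})}{\mathrm{lcm}(u_{i_0},\ldots,\check{u}_{i_s},\ldots,u_{i_q})}\, e_{i_0}\wedge\cdots\check{e}_{i_s}\cdots\wedge e_{i_q},$$ where $\check{\ }$ denotes omission, and the augmentation $\epsilon:T_0(I)\to I$ is $\epsilon(e_i)=u_i$. This is a free resolution of $I$; it is minimal if it is a minimal (multigraded) free resolution, i.e. $d_q(T_q(I))\subseteq (X_1,\ldots,X_n)T_{q-1}(I)$ for all $q\ge 1$. The ideal $I$ has linear quotients with respect to the order $u_1,\ldots,u_r$ of the elements of $G(I)$ if for each $j=1,\ldots,r$ the colon ideal $(u_1,\ldots,u_{j-1}):u_j$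 is generated by a subset of $\{X_1,\ldots,X_n\}$ (the empty subset, generating the zero ideal, for $j=1$). In this case $\mathrm{set}(u_j)=\{i_1,\ldots,i_s\}$, where $(u_1,\ldots,u_{j-1}):u_j=(X_{i_1},\ldots,X_{i_s})$ (so $\mathrm{set}(u_1)=\emptyset$). $\vert A\vert$ denotes the cardinality of a set $A$. *)

theory Defs
  imports Complex_Main "HOL-Library.Poly_Mapping"
begin

section \<open>The polynomial ring and its monomials\<close>

text \<open>\<open>('n, 'k) mpoly\<close> is the polynomial ring over \<open>'k\<close> whose variables are indexed by the finite
  type \<open>'n\<close>, so the number of variables is \<open>CARD('n)\<close>: a polynomial maps exponent vectors to
  coefficients, and the multiplication of \<^type>\<open>poly_mapping\<close> is convolution.\<close>

type_synonym ('n, 'k) mpoly = "('n \<Rightarrow>\<^sub>0 nat) \<Rightarrow>\<^sub>0 'k"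

definition monom :: "('n \<Rightarrow>\<^sub>0 nat) \<Rightarrow> ('n, 'k::zero_neq_one) mpoly"
  where "monom t = Poly_Mapping.single t 1"

definition Var :: "'n \<Rightarrow> ('n, 'k::zero_neq_one) mpoly"
  where "Var i = monom (Poly_Mapping.single i 1)"

lemma inj_monom: "inj (monom :: ('n \<Rightarrow>\<^sub>0 nat) \<Rightarrow> ('n, 'k::zero_neq_one) mpoly)"
proof (rule injI)
  fix s t :: "'n \<Rightarrow>\<^sub>0 nat"
  assume "(monom s :: ('n, 'k) mpoly) = monom t"
  then have "Poly_Mapping.keys (monom s :: ('n, 'k) mpoly) = Poly_Mapping.keys (monom t :: ('n, 'k) mpoly)"
    by simp
  then show "s = t"
    by (simp add: monom_def)
qed

text \<open>The exponent vector of a monomial; unspecified on other polynomials.\<close>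

definition expo :: "('n, 'k::zero_neq_one) mpoly \<Rightarrow> ('n \<Rightarrow>\<^sub>0 nat)"
  where "expo = inv monom"

lemma expo_monom [simp]: "expo (monom t) = t"
  by (simp add: expo_def inj_monom)

text \<open>The least common multiple of a finite set of monomials, by componentwise maxima of exponents
  (on \<^typ>\<open>nat\<close>, the supremum of the empty set is \<open>0\<close>), and the quotient \<open>a / b\<close> of a monomial \<open>a\<close>
  by a monomial \<open>b\<close> dividing it.\<close>

definition mon_lcm :: "('n::finite, 'k::zero_neq_one) mpoly set \<Rightarrow> ('n, 'k) mpoly"
  where "mon_lcm M =
    monom (Abs_poly_mapping (\<lambda>i. SUP m\<in>M. Poly_Mapping.lookup (expo m) i))"

definition mon_quot :: "('n, 'k::zero_neq_one) mpoly \<Rightarrow> ('n, 'k) mpoly \<Rightarrow> ('n, 'k) mpoly"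
  where "mon_quot a b = monom (expo a - expo b)"

lemma monom_mult:
  "monom s * monom t = (monom (s + t) :: ('n, 'k::comm_ring_1) mpoly)"
  by (simp add: monom_def mult_single)

lemma monom_dvd_iff:
  "(monom s :: ('n, 'k::comm_ring_1) mpoly) dvd monom t \<longleftrightarrow>
    (\<forall>i. Poly_Mapping.lookup s i \<le> Poly_Mapping.lookup t i)"
proof
  assume "(monom s :: ('n, 'k) mpoly) dvd monom t"
  then obtain p :: "('n, 'k) mpoly" where p: "monom t = monom s * p"
    by (auto elim: dvdE)
  have "t \<in> Poly_Mapping.keys (monom t :: ('n, 'k) mpoly)"
    by (simp add: monom_def)
  then have "t \<in> Poly_Mapping.keys (monom s * p)"
    by (simp only: p)
  then obtain v where "t = s + v"
    using keys_mult[of "monom s" p] by (auto simp: monom_def)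
  then show "\<forall>i. Poly_Mapping.lookup s i \<le> Poly_Mapping.lookup t i"
    by (simp add: lookup_add)
next
  assume le: "\<forall>i. Poly_Mapping.lookup s i \<le> Poly_Mapping.lookup t i"
  have "s + (t - s) = t"
    by (rule poly_mapping_eqI) (simp add: lookup_add lookup_minus le)
  then have "(monom t :: ('n, 'k) mpoly) = monom s * monom (t - s)"
    by (simp add: monom_mult)
  then show "(monom s :: ('n, 'k) mpoly) dvd monom t"
    by simp
qed

lemma mon_quot_mult:
  fixes a b :: "('n, 'k::comm_ring_1) mpoly"
  assumes "a \<in> range monom" "b \<in> range monom" "b dvd a"
  shows "mon_quot a b * b = a"
proof -
  obtain s t where st: "a = monom t" "b = monom s"
    using assms by blast
  then have le: "\<forall>i. Poly_Mapping.lookup s i \<le> Poly_Mapping.lookup t i"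
    using assms(3) by (simp add: monom_dvd_iff)
  have "t - s + s = t"
    by (rule poly_mapping_eqI) (simp add: lookup_add lookup_minus le)
  then show ?thesis
    by (simp add: st mon_quot_def monom_mult)
qed

lemma mon_lcm_dvd_iff:
  fixes M :: "('n::finite, 'k::comm_ring_1) mpoly set" and a :: "('n, 'k) mpoly"
  assumes "finite M" "M \<subseteq> range monom" "a \<in> range monom"
  shows "mon_lcm M dvd a \<longleftrightarrow> (\<forall>m\<in>M. m dvd a)"
proof -
  obtain t where t: "a = monom t"
    using assms by blast
  have fin: "finite {i::'n. f i \<noteq> (0::nat)}" for f
    by (rule finite_subset[OF subset_UNIV finite])
  have sup: "(SUP m\<in>M. f m) \<le> c \<longleftrightarrow> (\<forall>m\<in>M. f m \<le> c)" for f :: "('n, 'k) mpoly \<Rightarrow> nat" and c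
  proof (cases "M = {}")
    case True
    then show ?thesis
      by (simp add: Sup_nat_def)
  next
    case False
    then show ?thesis
      using assms(1) by (simp add: Sup_nat_def)
  qed
  have "mon_lcm M dvd a \<longleftrightarrow>
      (\<forall>i. \<forall>m\<in>M. Poly_Mapping.lookup (expo m) i \<le> Poly_Mapping.lookup t i)"
    by (simp add: mon_lcm_def t monom_dvd_iff fin sup)
  also have "\<dots> \<longleftrightarrow> (\<forall>m\<in>M. m dvd a)"
  proof -
    have "m dvd a \<longleftrightarrow> (\<forall>i. Poly_Mapping.lookup (expo m) i \<le> Poly_Mapping.lookup t i)"
      if m: "m \<in> M" for m
    proof -
      obtain s where "m = monom s"
        using m assms(2) by blast
      then show ?thesis
        by (simp add: t monom_dvd_iff)
    qed
    then show ?thesis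
      by blast
  qed
  finally show ?thesis .
qed


section \<open>Monomial ideals and linear quotients\<close>

lemma module_times: "module ((*) :: 'a::comm_ring_1 \<Rightarrow> 'a \<Rightarrow> 'a)"
  by standard (simp_all add: algebra_simps)

text \<open>The library's span in the module \<open>R\<close> over itself; the locale is not interpreted globally
  because its simp rule \<open>scale_scale\<close> would interfere with \<open>mult.assoc\<close>.\<close>

definition ideal_gen :: "'a::comm_ring_1 set \<Rightarrow> 'a set"
  where "ideal_gen = module.span (*)"

definition colon :: "'a::comm_ring_1 set \<Rightarrow> 'a \<Rightarrow> 'a set"
  where "colon J f = {p. p * f \<in> J}"

definition monomial_ideal :: "('n, 'k::field) mpoly set \<Rightarrow> bool"
  where "monomial_ideal I \<longleftrightarrow> (\<exists>M \<subseteq> range monom. I = ideal_gen M)"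

definition minimal_monomial_generators ::
    "('n, 'k::field) mpoly set \<Rightarrow> ('n, 'k) mpoly set \<Rightarrow> bool"
  where "minimal_monomial_generators I G \<longleftrightarrow>
    G \<subseteq> range monom \<and> ideal_gen G = I \<and> (\<forall>H. H \<subset> G \<longrightarrow> ideal_gen H \<noteq> I)"

text \<open>Sequences \<open>u 1, \<dots>, u r\<close> are indexed from \<open>1\<close>; values of \<open>u\<close> outside \<open>{1..r}\<close> are irrelevant.\<close>

definition linear_quotients :: "nat \<Rightarrow> (nat \<Rightarrow> ('n, 'k::field) mpoly) \<Rightarrow> bool"
  where "linear_quotients r u \<longleftrightarrow>
    (\<forall>j\<in>{1..r}. \<exists>A. colon (ideal_gen (u ` {1..<j})) (u j) = ideal_gen (Var ` A))"

definition lq_set :: "(nat \<Rightarrow> ('n, 'k::field) mpoly) \<Rightarrow> nat \<Rightarrow> 'n set"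
  where "lq_set u j = (THE A. colon (ideal_gen (u ` {1..<j})) (u j) = ideal_gen (Var ` A))"

lemma Var_in_ideal_gen_iff:
  "(Var i :: ('n, 'k::field) mpoly) \<in> ideal_gen (Var ` A) \<longleftrightarrow> i \<in> A"
proof
  interpret module "(*) :: ('n, 'k) mpoly \<Rightarrow> ('n, 'k) mpoly \<Rightarrow> ('n, 'k) mpoly"
    by (rule module_times)
  let ?P = "{p :: ('n, 'k) mpoly. \<forall>t\<in>Poly_Mapping.keys p. \<exists>a\<in>A. Poly_Mapping.lookup t a \<noteq> 0}"
  have "subspace ?P"
  proof (rule subspaceI)
    fix x y :: "('n, 'k) mpoly"
    assume "x \<in> ?P" "y \<in> ?P"
    then show "x + y \<in> ?P"
      using keys_add[of x y] by blast
  next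
    fix c x :: "('n, 'k) mpoly"
    assume x: "x \<in> ?P"
    have "\<exists>a\<in>A. Poly_Mapping.lookup t a \<noteq> 0" if t: "t \<in> Poly_Mapping.keys (c * x)" for t
    proof -
      obtain v w where "t = v + w" "w \<in> Poly_Mapping.keys x"
        using t keys_mult[of c x] by blast
      moreover obtain a where "a \<in> A" "Poly_Mapping.lookup w a \<noteq> 0"
        using x calculation by blast
      ultimately show ?thesis
        by (auto simp: lookup_add)
    qed
    then show "c * x \<in> ?P"
      by blast
  qed simp
  moreover have "Var ` A \<subseteq> ?P"
  proof
    fix p :: "('n, 'k) mpoly"
    assume "p \<in> Var ` A"
    then obtain a where a: "a \<in> A" "p = Var a"
      by blast
    have "\<exists>b\<in>A. Poly_Mapping.lookup (Poly_Mapping.single a (1::nat)) b \<noteq> 0"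
      by (rule bexI[OF _ a(1)]) simp
    then show "p \<in> ?P"
      by (simp add: a(2) Var_def monom_def)
  qed
  ultimately have "ideal_gen (Var ` A) \<subseteq> ?P"
    unfolding ideal_gen_def by (rule span_minimal[rotated])
  moreover assume "(Var i :: ('n, 'k) mpoly) \<in> ideal_gen (Var ` A)"
  ultimately have "(Var i :: ('n, 'k) mpoly) \<in> ?P"
    by (rule subsetD)
  then obtain a where "a \<in> A" "Poly_Mapping.lookup (Poly_Mapping.single i (1::nat)) a \<noteq> 0"
    by (simp add: Var_def monom_def del: One_nat_def) blast
  then show "i \<in> A"
    by (cases "i = a") (simp_all add: lookup_single_not_eq)
next
  interpret module "(*) :: ('n, 'k) mpoly \<Rightarrow> ('n, 'k) mpoly \<Rightarrow> ('n, 'k) mpoly"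
    by (rule module_times)
  show "i \<in> A \<Longrightarrow> (Var i :: ('n, 'k) mpoly) \<in> ideal_gen (Var ` A)"
    unfolding ideal_gen_def by (rule span_base) simp
qed

lemma lq_set_eqI:
  fixes u :: "nat \<Rightarrow> ('n, 'k::field) mpoly"
  assumes "colon (ideal_gen (u ` {1..<j})) (u j) = ideal_gen (Var ` A)"
  shows "lq_set u j = A"
  unfolding lq_set_def
proof (rule the_equality)
  show "colon (ideal_gen (u ` {1..<j})) (u j) = ideal_gen (Var ` A)"
    by (rule assms)
next
  fix B
  assume "colon (ideal_gen (u ` {1..<j})) (u j) = ideal_gen (Var ` B)"
  then have eq: "ideal_gen (Var ` B) = (ideal_gen (Var ` A) :: ('n, 'k) mpoly set)"
    using assms by simp
  show "B = A"
  proof (rule set_eqI)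
    fix i
    show "i \<in> B \<longleftrightarrow> i \<in> A"
      using Var_in_ideal_gen_iff[where 'k = 'k, of i A] Var_in_ideal_gen_iff[where 'k = 'k, of i B]
      by (simp only: eq)
  qed
qed


section \<open>The Taylor resolution\<close>

text \<open>A free module over a commutative ring \<open>R\<close> with basis in \<open>'b\<close> is rendered as \<open>'b \<Rightarrow>\<^sub>0 R\<close>,
  the basis element \<open>b\<close> being \<open>Poly_Mapping.single b 1\<close>.\<close>

definition fscale :: "'a::comm_ring_1 \<Rightarrow> ('b \<Rightarrow>\<^sub>0 'a) \<Rightarrow> ('b \<Rightarrow>\<^sub>0 'a)"
  where "fscale p = Poly_Mapping.map ((*) p)"

lemma lookup_fscale [simp]:
  "Poly_Mapping.lookup (fscale p x) b = p * Poly_Mapping.lookup x b"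
  by (simp add: fscale_def Poly_Mapping.map.rep_eq when_def)

lemma module_fscale: "module (fscale :: 'a::comm_ring_1 \<Rightarrow> ('b \<Rightarrow>\<^sub>0 'a) \<Rightarrow> _)"
  by standard (rule poly_mapping_eqI; simp add: lookup_add algebra_simps)+

text \<open>The exterior power \<open>\<Lambda>\<^sup>q\<^sup>+\<^sup>1 L\<close> of the free module \<open>L\<close> on \<open>e\<^sub>1, \<dots>, e\<^sub>r\<close> is free on the elements
  \<open>e\<^bsub>i\<^sub>0\<^esub> \<and> \<dots> \<and> e\<^bsub>i\<^sub>q\<^esub>\<close> with \<open>i\<^sub>0 < \<dots> < i\<^sub>q\<close>; such a basis element is encoded as the strictly increasing
  list \<open>[i\<^sub>0, \<dots>, i\<^sub>q]\<close>.\<close>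

definition taylor_basis :: "nat \<Rightarrow> nat \<Rightarrow> nat list set"
  where "taylor_basis r q =
    {xs. sorted_wrt (<) xs \<and> set xs \<subseteq> {1..r} \<and> length xs = q + 1}"

definition taylor_module :: "nat \<Rightarrow> nat \<Rightarrow> (nat list \<Rightarrow>\<^sub>0 ('n, 'k::field) mpoly) set"
  where "taylor_module r q = {x. Poly_Mapping.keys x \<subseteq> taylor_basis r q}"

definition omit :: "nat \<Rightarrow> 'b list \<Rightarrow> 'b list"
  where "omit s xs = take s xs @ drop (Suc s) xs"

definition taylor_diff_basis ::
    "(nat \<Rightarrow> ('n::finite, 'k::field) mpoly) \<Rightarrow> nat list \<Rightarrow> (nat list \<Rightarrow>\<^sub>0 ('n, 'k) mpoly)"
  where "taylor_diff_basis u xs =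
    (\<Sum>s<length xs. Poly_Mapping.single (omit s xs)
      ((-1) ^ s * mon_quot (mon_lcm (u ` set xs)) (mon_lcm (u ` set (omit s xs)))))"

text \<open>The linear extension; the differential \<open>d\<^sub>q\<close> is its restriction to \<open>taylor_module r q\<close>
  for \<open>q = 1, \<dots>, r - 1\<close>.\<close>

definition taylor_diff ::
    "(nat \<Rightarrow> ('n::finite, 'k::field) mpoly) \<Rightarrow>
      (nat list \<Rightarrow>\<^sub>0 ('n, 'k) mpoly) \<Rightarrow> (nat list \<Rightarrow>\<^sub>0 ('n, 'k) mpoly)"
  where "taylor_diff u x =
    (\<Sum>xs\<in>Poly_Mapping.keys x. fscale (Poly_Mapping.lookup x xs) (taylor_diff_basis u xs))"

text \<open>The product of an ideal and a submodule.\<close>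

definition ideal_mult ::
    "'a::comm_ring_1 set \<Rightarrow> ('b \<Rightarrow>\<^sub>0 'a) set \<Rightarrow> ('b \<Rightarrow>\<^sub>0 'a) set"
  where "ideal_mult J N = module.span fscale {fscale p x | p x. p \<in> J \<and> x \<in> N}"

definition taylor_minimal :: "nat \<Rightarrow> (nat \<Rightarrow> ('n::finite, 'k::field) mpoly) \<Rightarrow> bool"
  where "taylor_minimal r u \<longleftrightarrow>
    (\<forall>q\<in>{1..<r}. taylor_diff u ` taylor_module r q
        \<subseteq> ideal_mult (ideal_gen (range Var)) (taylor_module r (q - 1)))"

end

(* Comparing coefficients, the Taylor resolution is minimal iff no u_i divides the least common
   multiple of the other generators, that is, iff each u_i (for r >= 2) has a private variable in
   which its degree exceeds that of every other generator.

   For a in set(u_j) some u_l with l < j satisfies u_l / gcd(u_l, u_j) = X_a. If c(k) is a private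
   variable of u_k, this forces set(u_j) = {c(k) | k < j}. Conversely, if set(u_j) has j - 1
   elements, then each k < j satisfies u_k / gcd(u_k, u_j) = X_(c_j(k)) for distinct c_j(k). Then
   c_r(k) is private to u_k for k < r. Moreover u_j and u_r have the same degree in X_(c_r(k)) for
   k < j < r, so a variable in which u_r exceeds u_(r-1) is private to u_r. *)

theory Submission
  imports Defs
begin

section \<open>Exponents of linear quotients\<close>

text \<open>For \<open>F = {i}\<close> every \<open>c\<close> qualifies vacuously, so the comparison
  with quotients of least common multiples below assumes that another index remains.\<close>

definition private_variable :: "('i \<Rightarrow> 'v \<Rightarrow> nat) \<Rightarrow> 'i set \<Rightarrow> 'i \<Rightarrow> 'v \<Rightarrow> bool"
  where "private_variable e F i c \<longleftrightarrow> (\<forall>k\<in>F - {i}. e k c < e i c)"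

text \<open>Linear quotients reduced to combinatorics: \<open>e i\<close> is the exponent vector of
  the generator u_i, and \<open>A j\<close> is set(u_j). \<open>incomparable\<close> expresses
  minimality of the generators, \<open>covered\<close> that u_k / gcd(u_k, u_j) lies in the colon
  ideal, and \<open>attained\<close> that some earlier u_l divides X_a u_j.\<close>

locale lq_exponents =
  fixes r :: nat and e :: "nat \<Rightarrow> 'v \<Rightarrow> nat" and A :: "nat \<Rightarrow> 'v set"
  assumes incomparable: "i \<in> {1..r} \<Longrightarrow> k \<in> {1..r} \<Longrightarrow> i \<noteq> k \<Longrightarrow> \<exists>x. e k x < e i x"
    and covered: "j \<in> {1..r} \<Longrightarrow> k \<in> {1..<j} \<Longrightarrow> \<exists>a\<in>A j. e j a < e k a"
    and attained: "j \<in> {1..r} \<Longrightarrow> a \<in> A j \<Longrightarrow>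
      \<exists>l\<in>{1..<j}. \<forall>x. e l x \<le> (if x = a then 1 else 0) + e j x"
begin

text \<open>The generator u_l divides X_a u_j but, by incomparability, not u_j, so its excess over
  u_j is exactly one and sits at \<open>a\<close>.\<close>

lemma attained_exactly:
  assumes "j \<in> {1..r}" "a \<in> A j"
  shows "\<exists>l\<in>{1..<j}. e l a = Suc (e j a) \<and> (\<forall>x. x \<noteq> a \<longrightarrow> e l x \<le> e j x)"
proof -
  obtain l where l: "l \<in> {1..<j}" and le: "\<And>x. e l x \<le> (if x = a then 1 else 0) + e j x"
    using attained[OF assms] by blast
  have other: "e l x \<le> e j x" if "x \<noteq> a" for x
    using le[of x] that by simp
  obtain x where x: "e j x < e l x"
    using incomparable[of l j] l assms(1) by auto
  then have "x = a"
    using other[of x] by fastforce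
  then have "e l a = Suc (e j a)"
    using x le[of a] by simp
  then show ?thesis
    using l other by blast
qed

text \<open>A choice \<open>c\<close> of private variables turns out to be a bijection from
  \<open>{1..<j}\<close> onto \<open>A j\<close>.\<close>

lemma card_eq_if_private:
  assumes priv: "\<And>i. i \<in> {1..r} \<Longrightarrow> \<exists>c. private_variable e {1..r} i c"
    and j: "j \<in> {1..r}"
  shows "card (A j) = j - 1"
proof -
  obtain c where c: "\<And>i k. i \<in> {1..r} \<Longrightarrow> k \<in> {1..r} \<Longrightarrow> k \<noteq> i \<Longrightarrow> e k (c i) < e i (c i)"
    using priv unfolding private_variable_def by (metis DiffI singletonD)
  have in_range: "k \<in> {1..r}" "k \<noteq> j" if "k \<in> {1..<j}" for k
    using that j by auto
  have source: "\<exists>l\<in>{1..<j}. a = c l \<and> e l a = Suc (e j a)" if a: "a \<in> A j" for a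
  proof -
    obtain l where l: "l \<in> {1..<j}" "e l a = Suc (e j a)" "\<And>x. x \<noteq> a \<Longrightarrow> e l x \<le> e j x"
      using attained_exactly[OF j a] by blast
    \<comment> \<open>u_l exceeds u_j in its private variable, and \<open>a\<close> is the only
      variable where it does.\<close>
    have "e j (c l) < e l (c l)"
      using c[of l j] in_range[OF l(1)] j by auto
    then have "a = c l"
      using l(3)[of "c l"] by fastforce
    then show ?thesis
      using l by blast
  qed
  have "c k \<in> A j" if k: "k \<in> {1..<j}" for k
  proof -
    obtain a where a: "a \<in> A j" "e j a < e k a"
      using covered[OF j k] by blast
    obtain l where l: "l \<in> {1..<j}" "a = c l" "e l a = Suc (e j a)"
      using source[OF a(1)] by blast
    \<comment> \<open>Otherwise privacy of \<open>a = c l\<close> gives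
      \<open>e k a < e l a = Suc (e j a)\<close>, against \<open>e j a < e k a\<close>.\<close>
    have "l = k"
      using c[of l k] in_range[OF l(1)] in_range[OF k] l a(2) by fastforce
    then show ?thesis
      using a(1) l(2) by simp
  qed
  then have "A j = c ` {1..<j}"
    using source by blast
  moreover have "inj_on c {1..<j}"
  proof (rule inj_onI)
    fix k l assume kl: "k \<in> {1..<j}" "l \<in> {1..<j}" "c k = c l"
    show "k = l"
      using c[of k l] c[of l k] in_range[OF kl(1)] in_range[OF kl(2)] kl(3)
      by fastforce
  qed
  ultimately show ?thesis
    by (simp add: card_image)
qed

text \<open>Each \<open>a \<in> A j\<close> comes from an earlier index \<open>l a\<close> exceeding
  \<open>j\<close> only at \<open>a\<close>, so \<open>l\<close> is injective. The cardinality makes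
  it a bijection onto \<open>{1..<j}\<close>, and \<open>c\<close> is its inverse.\<close>

lemma quotient_variables:
  assumes j: "j \<in> {1..r}" and card: "card (A j) = j - 1"
  obtains c where "inj_on c {1..<j}"
    and "\<And>k. k \<in> {1..<j} \<Longrightarrow> e k (c k) = Suc (e j (c k))"
    and "\<And>k x. k \<in> {1..<j} \<Longrightarrow> x \<noteq> c k \<Longrightarrow> e k x \<le> e j x"
proof -
  obtain l where l: "\<And>a. a \<in> A j \<Longrightarrow> l a \<in> {1..<j}"
    "\<And>a. a \<in> A j \<Longrightarrow> e (l a) a = Suc (e j a)"
    "\<And>a x. a \<in> A j \<Longrightarrow> x \<noteq> a \<Longrightarrow> e (l a) x \<le> e j x"
    using attained_exactly[OF j] by metis
  have inj: "inj_on l (A j)"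
  proof (rule inj_onI)
    fix a b assume ab: "a \<in> A j" "b \<in> A j" "l a = l b"
    show "a = b"
      using l(2)[OF ab(1)] l(3)[OF ab(2), of a] ab(3) by fastforce
  qed
  have "l ` A j = {1..<j}"
    using l(1) card by (intro card_subset_eq) (auto simp: card_image[OF inj])
  then have bij: "bij_betw l (A j) {1..<j}"
    using inj by (simp add: bij_betw_def)
  let ?c = "inv_into (A j) l"
  have c: "?c k \<in> A j" "l (?c k) = k" if "k \<in> {1..<j}" for k
    using bij that by (auto simp: bij_betw_def f_inv_into_f inv_into_into)
  show thesis
  proof
    show "inj_on ?c {1..<j}"
      using bij_betw_inv_into[OF bij] by (simp add: bij_betw_def)
    show "e k (?c k) = Suc (e j (?c k))" if "k \<in> {1..<j}" for k
      using l(2)[OF c(1)[OF that]] c(2)[OF that] by simp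
    show "e k x \<le> e j x" if "k \<in> {1..<j}" "x \<noteq> ?c k" for k x
      using l(3)[OF c(1)[OF that(1)] that(2)] c(2)[OF that(1)] by simp
  qed
qed

text \<open>Compares the quotient variables \<open>c\<close> at \<open>r\<close> with the quotient
  variables \<open>d\<close> at \<open>r - 1\<close>. The former serve the indices below
  \<open>r\<close>; a variable separating \<open>r\<close> from \<open>r - 1\<close> serves
  \<open>r\<close> itself.\<close>

lemma private_if_card_eq:
  assumes card: "\<And>j. j \<in> {1..r} \<Longrightarrow> card (A j) = j - 1"
    and r: "2 \<le> r" and i: "i \<in> {1..r}"
  shows "\<exists>b. private_variable e {1..r} i b"
proof -
  have r_in: "r \<in> {1..r}"
    using r by simp
  obtain c where inj: "inj_on c {1..<r}"
    and c: "\<And>k. k \<in> {1..<r} \<Longrightarrow> e k (c k) = Suc (e r (c k))"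
    and other: "\<And>k x. k \<in> {1..<r} \<Longrightarrow> x \<noteq> c k \<Longrightarrow> e k x \<le> e r x"
    using quotient_variables[OF r_in card[OF r_in]] by metis
  \<comment> \<open>Only \<open>l\<close> can exceed \<open>r\<close> in the variable
    \<open>c l\<close>, because \<open>c\<close> is injective.\<close>
  have small: "e k (c l) \<le> e r (c l)" if "k \<in> {1..r}" "l \<in> {1..<r}" "k \<noteq> l" for k l
  proof (cases "k = r")
    case False
    then have "k \<in> {1..<r}"
      using that(1) by auto
    then show ?thesis
      using other[of k "c l"] inj_onD[OF inj, of l k] that by auto
  qed simp
  show ?thesis
  proof (cases "i = r")
    case False
    then have i': "i \<in> {1..<r}"
      using i by auto
    have "e k (c i) < e i (c i)" if "k \<in> {1..r} - {i}" for k
      using small[of k i] c[OF i'] that i' by fastforce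
    then show ?thesis
      unfolding private_variable_def by blast
  next
    case True
    let ?p = "r - 1"
    have p: "?p \<in> {1..r}" "?p \<in> {1..<r}"
      using r by auto
    \<comment> \<open>\<open>b\<close> is the candidate for \<open>r\<close>; it remains to bound
      the exponents at \<open>b\<close> of the indices below \<open>?p\<close> by that of
      \<open>?p\<close>.\<close>
    obtain b where b: "e ?p b < e r b"
      using incomparable[OF r_in p(1)] p(2) by auto
    obtain d where d: "\<And>k. k \<in> {1..<?p} \<Longrightarrow> e k (d k) = Suc (e ?p (d k))"
      and d_other: "\<And>k x. k \<in> {1..<?p} \<Longrightarrow> x \<noteq> d k \<Longrightarrow> e k x \<le> e ?p x"
      using quotient_variables[OF p(1) card[OF p(1)]] by metis
    have "e k b \<le> e ?p b" if k: "k \<in> {1..<?p}" for k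
    proof -
      have k': "k \<in> {1..<r}" "k \<noteq> ?p"
        using k by auto
      \<comment> \<open>Hence \<open>k\<close> exceeds \<open>?p\<close> at \<open>c k\<close>, and
        the only variable where it can do so is \<open>d k\<close>.\<close>
      have "e ?p (c k) \<le> e r (c k)"
        using small[of ?p k] p k' by blast
      then have "d k = c k"
        using d_other[OF k, of "c k"] c[OF k'(1)] by fastforce
      \<comment> \<open>Both excesses of \<open>k\<close> at this variable are one, so
        \<open>?p\<close> and \<open>r\<close> agree there, whereas they differ at
        \<open>b\<close>.\<close>
      then have "e ?p (c k) = e r (c k)"
        using d[OF k] c[OF k'(1)] by simp
      then have "b \<noteq> d k"
        using b \<open>d k = c k\<close> by auto
      then show ?thesis
        using d_other[OF k] by blast
    qed
    moreover have "k = ?p \<or> k \<in> {1..<?p}" if "k \<in> {1..r} - {r}" for k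
      using that by fastforce
    ultimately have "e k b < e r b" if "k \<in> {1..r} - {r}" for k
      using that b by (metis le_less_trans)
    then show ?thesis
      using True unfolding private_variable_def by blast
  qed
qed

end

section \<open>Monomials in monomial ideals\<close>

text \<open>For the forward direction, the polynomials all of whose terms are divisible by some
  generator form an ideal containing the generators.\<close>

lemma monom_in_ideal_gen_iff:
  "(monom t :: ('n, 'k::field) mpoly) \<in> ideal_gen (monom ` T) \<longleftrightarrow>
    (\<exists>s\<in>T. \<forall>x. Poly_Mapping.lookup s x \<le> Poly_Mapping.lookup t x)"
proof
  interpret module "(*) :: ('n, 'k) mpoly \<Rightarrow> ('n, 'k) mpoly \<Rightarrow> ('n, 'k) mpoly"
    by (rule module_times)
  let ?le = "\<lambda>s t. \<forall>x. Poly_Mapping.lookup s x \<le> (Poly_Mapping.lookup t x :: nat)"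
  let ?P = "{p :: ('n, 'k) mpoly. \<forall>t\<in>Poly_Mapping.keys p. \<exists>s\<in>T. ?le s t}"
  have "subspace ?P"
  proof (rule subspaceI)
    fix x y :: "('n, 'k) mpoly"
    assume "x \<in> ?P" "y \<in> ?P"
    then show "x + y \<in> ?P"
      using keys_add[of x y] by blast
  next
    fix c x :: "('n, 'k) mpoly"
    assume x: "x \<in> ?P"
    have "\<exists>s\<in>T. ?le s t" if t: "t \<in> Poly_Mapping.keys (c * x)" for t
    proof -
      obtain v w where vw: "t = v + w" "w \<in> Poly_Mapping.keys x"
        using t keys_mult[of c x] by blast
      then obtain s where "s \<in> T" "?le s w"
        using x by blast
      then show ?thesis
        using vw(1) by (auto simp: lookup_add intro!: bexI[of _ s] trans_le_add2)
    qed
    then show "c * x \<in> ?P"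
      by blast
  qed simp
  moreover have "monom ` T \<subseteq> ?P"
    by (auto simp: monom_def)
  ultimately have "ideal_gen (monom ` T) \<subseteq> ?P"
    unfolding ideal_gen_def by (rule span_minimal[rotated])
  moreover assume "(monom t :: ('n, 'k) mpoly) \<in> ideal_gen (monom ` T)"
  ultimately have "(monom t :: ('n, 'k) mpoly) \<in> ?P"
    by (rule subsetD)
  then show "\<exists>s\<in>T. ?le s t"
    by (simp add: monom_def)
next
  interpret module "(*) :: ('n, 'k) mpoly \<Rightarrow> ('n, 'k) mpoly \<Rightarrow> ('n, 'k) mpoly"
    by (rule module_times)
  assume "\<exists>s\<in>T. \<forall>x. Poly_Mapping.lookup s x \<le> Poly_Mapping.lookup t x"
  then obtain s where s: "s \<in> T" "(monom s :: ('n, 'k) mpoly) dvd monom t"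
    by (auto simp: monom_dvd_iff)
  then obtain p :: "('n, 'k) mpoly" where "monom t = p * monom s"
    by (metis dvdE mult.commute)
  moreover have "p * monom s \<in> ideal_gen (monom ` T)"
    unfolding ideal_gen_def by (rule span_scale[OF span_base]) (simp add: s(1))
  ultimately show "(monom t :: ('n, 'k) mpoly) \<in> ideal_gen (monom ` T)"
    by simp
qed

lemma monom_in_ideal_gen_Var_iff:
  "(monom t :: ('n, 'k::field) mpoly) \<in> ideal_gen (Var ` A) \<longleftrightarrow>
    (\<exists>a\<in>A. Poly_Mapping.lookup t a \<noteq> 0)"
proof -
  have single_le: "(\<forall>x. Poly_Mapping.lookup (Poly_Mapping.single a (1::nat)) x \<le> Poly_Mapping.lookup t x)
      \<longleftrightarrow> Poly_Mapping.lookup t a \<noteq> 0" for a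
    by (auto simp: lookup_single when_def Suc_le_eq)
  have "(Var ` A :: ('n, 'k) mpoly set) = monom ` (\<lambda>a. Poly_Mapping.single a 1) ` A"
    by (auto simp: Var_def image_image)
  then show ?thesis
    by (simp add: monom_in_ideal_gen_iff single_le del: One_nat_def)
qed

lemma monom_expo:
  assumes "p \<in> range monom"
  shows "monom (expo p) = p"
  using assms by auto

lemma monom_in_ideal_gen_monomials_iff:
  fixes M :: "('n, 'k::field) mpoly set"
  assumes "M \<subseteq> range monom"
  shows "monom t \<in> ideal_gen M \<longleftrightarrow>
    (\<exists>m\<in>M. \<forall>x. Poly_Mapping.lookup (expo m) x \<le> Poly_Mapping.lookup t x)"
proof -
  have M: "M = monom ` expo ` M"
    using assms monom_expo by (force simp: image_iff)
  show ?thesis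
    by (subst M, subst monom_in_ideal_gen_iff) simp
qed

text \<open>If \<open>p\<close> divided \<open>q\<close>, then \<open>q\<close> would be redundant
  and \<open>G - {q}\<close> would still generate \<open>I\<close>.\<close>

lemma minimal_generators_incomparable:
  assumes G: "minimal_monomial_generators I G" and mem: "p \<in> G" "q \<in> G" "p \<noteq> q"
  shows "\<exists>x. Poly_Mapping.lookup (expo q) x < Poly_Mapping.lookup (expo p) x"
proof (rule ccontr)
  interpret module "(*) :: ('a, 'b) mpoly \<Rightarrow> ('a, 'b) mpoly \<Rightarrow> ('a, 'b) mpoly"
    by (rule module_times)
  assume "\<not> ?thesis"
  then have le: "Poly_Mapping.lookup (expo p) x \<le> Poly_Mapping.lookup (expo q) x" for x
    by (meson not_le)
  have G': "G \<subseteq> range monom" "ideal_gen G = I" "\<And>H. H \<subset> G \<Longrightarrow> ideal_gen H \<noteq> I"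
    using G by (auto simp: minimal_monomial_generators_def)
  have "monom (expo q) \<in> ideal_gen (G - {q})"
    using G'(1) mem le by (subst monom_in_ideal_gen_monomials_iff) auto
  then have "q \<in> ideal_gen (G - {q})"
    using monom_expo[of q] G'(1) mem(2) by auto
  then have "ideal_gen (insert q (G - {q})) = ideal_gen (G - {q})"
    unfolding ideal_gen_def span_def by (rule hull_redundant)
  then have "ideal_gen (G - {q}) = I"
    using G'(2) mem(2) by (simp add: insert_absorb)
  then show False
    using G'(3)[of "G - {q}"] mem(2) by blast
qed

text \<open>The equality of ideals defining linear quotients is evaluated at suitable monomials,
  where membership is divisibility.\<close>

lemma lq_exponents_generators:
  fixes u :: "nat \<Rightarrow> ('n, 'k::field) mpoly"
  assumes inj: "inj_on u {1..r}"
    and min: "minimal_monomial_generators I (u ` {1..r})"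
    and lq: "linear_quotients r u"
  shows "lq_exponents r (\<lambda>i. Poly_Mapping.lookup (expo (u i))) (lq_set u)"
proof
  have u_mon: "u i \<in> range monom" if "i \<in> {1..r}" for i
    using min that by (auto simp: minimal_monomial_generators_def)
  have colon_eq: "colon (ideal_gen (u ` {1..<j})) (u j) = ideal_gen (Var ` lq_set u j)"
    if "j \<in> {1..r}" for j
    using lq that unfolding linear_quotients_def by (metis lq_set_eqI)
  \<comment> \<open>Both sides express that the monomial with exponent \<open>t\<close> lies in the
    colon ideal: the left by the variables generating it, the right by divisibility of its product
    with \<open>u j\<close>.\<close>
  have colon_iff: "(\<exists>a\<in>lq_set u j. Poly_Mapping.lookup t a \<noteq> 0) \<longleftrightarrow>
      (\<exists>l\<in>{1..<j}. \<forall>x. Poly_Mapping.lookup (expo (u l)) x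
        \<le> Poly_Mapping.lookup t x + Poly_Mapping.lookup (expo (u j)) x)"
    if j: "j \<in> {1..r}" for j t
  proof -
    have sub: "u ` {1..<j} \<subseteq> range monom"
      using u_mon j by auto
    have "(\<exists>a\<in>lq_set u j. Poly_Mapping.lookup t a \<noteq> 0) \<longleftrightarrow>
        monom t \<in> colon (ideal_gen (u ` {1..<j})) (u j)"
      by (simp only: colon_eq[OF j] monom_in_ideal_gen_Var_iff)
    also have "\<dots> \<longleftrightarrow> monom (t + expo (u j)) \<in> ideal_gen (u ` {1..<j})"
      by (simp add: colon_def monom_mult[symmetric] monom_expo[OF u_mon[OF j]])
    also have "\<dots> \<longleftrightarrow> (\<exists>l\<in>{1..<j}. \<forall>x. Poly_Mapping.lookup (expo (u l)) x
        \<le> Poly_Mapping.lookup t x + Poly_Mapping.lookup (expo (u j)) x)"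
      unfolding monom_in_ideal_gen_monomials_iff[OF sub] by (simp add: lookup_add)
    finally show ?thesis .
  qed
  show "\<exists>x. Poly_Mapping.lookup (expo (u k)) x < Poly_Mapping.lookup (expo (u i)) x"
    if "i \<in> {1..r}" "k \<in> {1..r}" "i \<noteq> k" for i k
    using that inj_onD[OF inj, of i k] by (intro minimal_generators_incomparable[OF min]) auto
  show "\<exists>a\<in>lq_set u j. Poly_Mapping.lookup (expo (u j)) a < Poly_Mapping.lookup (expo (u k)) a"
    if j: "j \<in> {1..r}" and k: "k \<in> {1..<j}" for j k
  proof -
    \<comment> \<open>Subtraction is truncated, so this \<open>t\<close> is the exponent of u_k /
      gcd(u_k, u_j).\<close>
    have "\<exists>a\<in>lq_set u j. Poly_Mapping.lookup (expo (u k) - expo (u j)) a \<noteq> 0"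
      unfolding colon_iff[OF j] using k by (intro bexI[of _ k]) (auto simp: lookup_minus)
    then show ?thesis
      by (simp add: lookup_minus not_le)
  qed
  show "\<exists>l\<in>{1..<j}. \<forall>x. Poly_Mapping.lookup (expo (u l)) x
      \<le> (if x = a then 1 else 0) + Poly_Mapping.lookup (expo (u j)) x"
    if j: "j \<in> {1..r}" and a: "a \<in> lq_set u j" for j a
  proof -
    \<comment> \<open>Here \<open>t\<close> is the exponent of the variable X_a itself.\<close>
    have "\<exists>b\<in>lq_set u j. Poly_Mapping.lookup (Poly_Mapping.single a (1::nat)) b \<noteq> 0"
      using a by (intro bexI[of _ a]) simp_all
    then obtain l where l: "l \<in> {1..<j}"
      "\<And>x. Poly_Mapping.lookup (expo (u l)) x
        \<le> Poly_Mapping.lookup (Poly_Mapping.single a 1) x + Poly_Mapping.lookup (expo (u j)) x"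
      unfolding colon_iff[OF j] by blast
    have "Poly_Mapping.lookup (expo (u l)) x
        \<le> (if x = a then 1 else 0) + Poly_Mapping.lookup (expo (u j)) x" for x
      using l(2)[of x] by (auto simp: lookup_single when_def split: if_splits)
    then show ?thesis
      using l(1) by blast
  qed
qed

section \<open>Minimality of the Taylor resolution\<close>

lemma lookup_expo_mon_lcm:
  fixes M :: "('n::finite, 'k::zero_neq_one) mpoly set"
  shows "Poly_Mapping.lookup (expo (mon_lcm M)) x = (SUP m\<in>M. Poly_Mapping.lookup (expo m) x)"
  by (simp add: mon_lcm_def)

text \<open>Nonemptiness lets \<open>Sup\<close> be read as \<open>Max\<close>. For
  \<open>F = {i}\<close> the left side would say \<open>0 < f i\<close>, while the right side holds
  vacuously.\<close>

lemma Sup_nat_image_less_iff: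
  fixes f :: "'i \<Rightarrow> nat"
  assumes "finite F" "i \<in> F" "F - {i} \<noteq> {}"
  shows "(SUP k\<in>F - {i}. f k) < (SUP k\<in>F. f k) \<longleftrightarrow> (\<forall>k\<in>F - {i}. f k < f i)"
proof -
  have "(SUP k\<in>F. f k) = max (f i) (SUP k\<in>F - {i}. f k)"
  proof -
    have "F = insert i (F - {i})"
      using assms(2) by blast
    then have "(SUP k\<in>F. f k) = Max (insert (f i) (f ` (F - {i})))"
      using assms(1) by (metis Sup_nat_def finite_imageI image_insert insert_not_empty)
    also have "\<dots> = max (f i) (SUP k\<in>F - {i}. f k)"
      using assms by (simp add: Sup_nat_def)
    finally show ?thesis .
  qed
  moreover have "(SUP k\<in>F - {i}. f k) < f i \<longleftrightarrow> (\<forall>k\<in>F - {i}. f k < f i)"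
    using assms by (simp add: Sup_nat_def)
  ultimately show ?thesis
    by (simp add: less_max_iff_disj)
qed

text \<open>A monomial lies in the maximal ideal iff some exponent is positive, that is, iff
  omitting \<open>i\<close> lowers some exponent of the least common multiple.\<close>

lemma mon_quot_lcm_in_maximal_ideal_iff:
  fixes u :: "nat \<Rightarrow> ('n::finite, 'k::field) mpoly"
  assumes "finite F" "i \<in> F" "F - {i} \<noteq> {}"
  shows "mon_quot (mon_lcm (u ` F)) (mon_lcm (u ` (F - {i}))) \<in> ideal_gen (range Var) \<longleftrightarrow>
    (\<exists>c. private_variable (\<lambda>i. Poly_Mapping.lookup (expo (u i))) F i c)"
proof -
  let ?e = "\<lambda>i. Poly_Mapping.lookup (expo (u i))"
  have "mon_quot (mon_lcm (u ` F)) (mon_lcm (u ` (F - {i}))) \<in> ideal_gen (range Var) \<longleftrightarrow>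
      (\<exists>c. (SUP k\<in>F - {i}. ?e k c) < (SUP k\<in>F. ?e k c))"
    by (simp add: mon_quot_def monom_in_ideal_gen_Var_iff lookup_minus lookup_expo_mon_lcm
        image_image not_le)
  then show ?thesis
    by (simp only: Sup_nat_image_less_iff[OF assms] private_variable_def)
qed

lemma neg_one_power_mult_mem_ideal_gen_iff:
  "(-1) ^ s * p \<in> ideal_gen B \<longleftrightarrow> p \<in> ideal_gen B"
proof -
  interpret module "(*) :: 'a \<Rightarrow> 'a \<Rightarrow> 'a"
    by (rule module_times)
  have "p \<in> span B \<Longrightarrow> (-1) ^ s * p \<in> span B" for p
    by (rule span_scale)
  \<comment> \<open>Multiplying by the sign twice gives back \<open>p\<close>.\<close>
  from this[of p] this[of "(-1) ^ s * p"] show ?thesis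
    by (auto simp: ideal_gen_def mult.assoc[symmetric] power_add[symmetric])
qed

section \<open>Omitting entries and the coefficients of the differential\<close>

lemma set_omit:
  assumes "distinct xs" "s < length xs"
  shows "set (omit s xs) = set xs - {xs ! s}"
proof -
  have "xs = take s xs @ xs ! s # drop (Suc s) xs"
    using assms(2) by (rule id_take_nth_drop)
  then have "set xs = set (take s xs @ xs ! s # drop (Suc s) xs)"
    and "distinct (take s xs @ xs ! s # drop (Suc s) xs)"
    using assms(1) by metis+
  then show ?thesis
    by (auto simp: omit_def)
qed

lemma length_omit: "s < length xs \<Longrightarrow> length (omit s xs) = length xs - 1"
  by (simp add: omit_def)

text \<open>Ensures that distinct terms of the differential sit on distinct basis elements, so none
  cancel.\<close>

lemma inj_on_omit:
  assumes "distinct xs"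
  shows "inj_on (\<lambda>s. omit s xs) {..<length xs}"
proof (rule inj_onI)
  fix s t assume st: "s \<in> {..<length xs}" "t \<in> {..<length xs}" "omit s xs = omit t xs"
  then have "set xs - {xs ! s} = set xs - {xs ! t}"
    using set_omit[OF assms, of s] set_omit[OF assms, of t] by simp
  moreover have "xs ! s \<in> set xs" "xs ! t \<in> set xs"
    using st(1,2) by simp_all
  ultimately have "xs ! s = xs ! t"
    by blast
  then show "s = t"
    using nth_eq_iff_index_eq[OF assms] st(1,2) by simp
qed

lemma omit_in_taylor_basis:
  assumes "xs \<in> taylor_basis r (Suc q)" "s < length xs"
  shows "omit s xs \<in> taylor_basis r q"
proof -
  have xs: "sorted_wrt (<) xs" "set xs \<subseteq> {1..r}" "length xs = Suc q + 1"
    using assms(1) by (auto simp: taylor_basis_def)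
  have "sorted_wrt (<) (take s xs @ xs ! s # drop (Suc s) xs)"
    using xs(1) assms(2) by (simp add: id_take_nth_drop[symmetric])
  then have "sorted_wrt (<) (omit s xs)"
    by (auto simp: omit_def sorted_wrt_append)
  moreover have "set (omit s xs) \<subseteq> {1..r}"
    using xs assms(2) by (auto simp: set_omit strict_sorted_iff)
  ultimately show ?thesis
    using xs(3) assms(2) by (simp add: taylor_basis_def length_omit)
qed

lemma lookup_taylor_diff_basis_omit:
  assumes "distinct xs" "s < length xs"
  shows "Poly_Mapping.lookup (taylor_diff_basis u xs) (omit s xs) =
    (-1) ^ s * mon_quot (mon_lcm (u ` set xs)) (mon_lcm (u ` set (omit s xs)))"
proof -
  let ?q = "\<lambda>t. (-1) ^ t * mon_quot (mon_lcm (u ` set xs)) (mon_lcm (u ` set (omit t xs)))"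
  have "Poly_Mapping.lookup (taylor_diff_basis u xs) (omit s xs) =
      (\<Sum>t<length xs. Poly_Mapping.lookup (Poly_Mapping.single (omit t xs) (?q t)) (omit s xs))"
    by (simp add: taylor_diff_basis_def lookup_sum)
  also have "\<dots> = (\<Sum>t<length xs. if t = s then ?q t else 0)"
    using inj_onD[OF inj_on_omit[OF assms(1)], of _ s] assms(2)
    by (intro sum.cong) (auto simp: lookup_single when_def)
  also have "\<dots> = ?q s"
    using assms(2) by simp
  finally show ?thesis .
qed

section \<open>Membership in the product of an ideal and a submodule\<close>

text \<open>The elements whose coefficient at \<open>b\<close> lies in the ideal form a submodule
  containing all generators of the product.\<close>

lemma lookup_ideal_mult:
  fixes x :: "'b \<Rightarrow>\<^sub>0 'a::comm_ring_1"
  assumes "x \<in> ideal_mult (ideal_gen B) N"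
  shows "Poly_Mapping.lookup x b \<in> ideal_gen B"
proof -
  interpret R: module "(*) :: 'a \<Rightarrow> 'a \<Rightarrow> 'a"
    by (rule module_times)
  interpret F: module "fscale :: 'a \<Rightarrow> ('b \<Rightarrow>\<^sub>0 'a) \<Rightarrow> _"
    by (rule module_fscale)
  have "F.subspace {x. Poly_Mapping.lookup x b \<in> R.span B}"
    by (rule F.subspaceI) (simp_all add: lookup_add R.span_zero R.span_add R.span_scale)
  moreover have "{fscale p x | p x. p \<in> ideal_gen B \<and> x \<in> N}
      \<subseteq> {x. Poly_Mapping.lookup x b \<in> R.span B}"
    by (auto simp: ideal_gen_def mult.commute[of _ "Poly_Mapping.lookup _ b"] R.span_scale)
  ultimately have "ideal_mult (ideal_gen B) N \<subseteq> {x. Poly_Mapping.lookup x b \<in> R.span B}"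
    unfolding ideal_mult_def by (rule F.span_minimal[rotated])
  then show ?thesis
    using assms by (auto simp: ideal_gen_def)
qed

lemma single_in_ideal_mult:
  fixes p :: "'a::comm_ring_1"
  assumes "p \<in> J" "Poly_Mapping.single b 1 \<in> N"
  shows "Poly_Mapping.single b p \<in> ideal_mult J N"
proof -
  interpret module "fscale :: 'a \<Rightarrow> ('b \<Rightarrow>\<^sub>0 'a) \<Rightarrow> _"
    by (rule module_fscale)
  have "Poly_Mapping.single b p = fscale p (Poly_Mapping.single b 1)"
    by (rule poly_mapping_eqI) (simp add: lookup_single when_def)
  then show ?thesis
    unfolding ideal_mult_def using assms by (intro span_base) blast
qed

lemma taylor_diff_single: "taylor_diff u (Poly_Mapping.single xs 1) = taylor_diff_basis u xs"
  by (rule poly_mapping_eqI) (simp add: taylor_diff_def)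

lemma taylor_diff_in_ideal_mult:
  assumes "\<And>xs. xs \<in> Poly_Mapping.keys x \<Longrightarrow> taylor_diff_basis u xs \<in> ideal_mult J N"
  shows "taylor_diff u x \<in> ideal_mult J N"
proof -
  interpret module "fscale :: ('a, 'b) mpoly \<Rightarrow> (nat list \<Rightarrow>\<^sub>0 ('a, 'b) mpoly) \<Rightarrow> _"
    by (rule module_fscale)
  show ?thesis
    using assms unfolding taylor_diff_def ideal_mult_def by (intro span_sum span_scale)
qed

lemma taylor_diff_basis_in_ideal_mult:
  fixes u :: "nat \<Rightarrow> ('n::finite, 'k::field) mpoly"
  assumes xs: "xs \<in> taylor_basis r (Suc q)"
    and priv: "\<And>i. i \<in> {1..r} \<Longrightarrow>
      \<exists>c. private_variable (\<lambda>i. Poly_Mapping.lookup (expo (u i))) {1..r} i c"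
  shows "taylor_diff_basis u xs \<in> ideal_mult (ideal_gen (range Var)) (taylor_module r q)"
proof -
  interpret module "fscale :: ('n, 'k) mpoly \<Rightarrow> (nat list \<Rightarrow>\<^sub>0 ('n, 'k) mpoly) \<Rightarrow> _"
    by (rule module_fscale)
  have xs': "distinct xs" "set xs \<subseteq> {1..r}" "length xs = Suc q + 1"
    using xs by (auto simp: taylor_basis_def strict_sorted_iff)
  have "Poly_Mapping.single (omit s xs)
      ((-1) ^ s * mon_quot (mon_lcm (u ` set xs)) (mon_lcm (u ` set (omit s xs))))
      \<in> ideal_mult (ideal_gen (range Var)) (taylor_module r q)" if s: "s < length xs" for s
  proof (rule single_in_ideal_mult)
    show "Poly_Mapping.single (omit s xs) 1 \<in> taylor_module r q"
      using omit_in_taylor_basis[OF xs s] by (simp add: taylor_module_def)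
    have i: "xs ! s \<in> set xs" "xs ! s \<in> {1..r}"
      using s xs'(2) nth_mem by blast+
    \<comment> \<open>In degree \<open>Suc q\<close> the list \<open>xs\<close> has at least two
      entries.\<close>
    have "set (omit s xs) \<noteq> {}"
      using length_omit[OF s] xs'(3) by auto
    then have ne: "set xs - {xs ! s} \<noteq> {}"
      using set_omit[OF xs'(1) s] by simp
    \<comment> \<open>Passing from \<open>{1..r}\<close> to \<open>set xs\<close> only removes
      competitors, so privacy persists.\<close>
    have "\<exists>c. private_variable (\<lambda>i. Poly_Mapping.lookup (expo (u i))) (set xs) (xs ! s) c"
      using priv[OF i(2)] xs'(2) unfolding private_variable_def by blast
    then show "(-1) ^ s * mon_quot (mon_lcm (u ` set xs)) (mon_lcm (u ` set (omit s xs)))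
        \<in> ideal_gen (range Var)"
      using mon_quot_lcm_in_maximal_ideal_iff[OF finite_set i(1) ne, of u]
      by (simp only: neg_one_power_mult_mem_ideal_gen_iff set_omit[OF xs'(1) s])
  qed
  then show ?thesis
    unfolding taylor_diff_basis_def ideal_mult_def by (intro span_sum) simp
qed

text \<open>The top differential alone already yields all private variables; conversely, these
  handle every degree. The bound \<open>2 \<le> r\<close> places the top degree \<open>r - 1\<close>
  in \<open>{1..<r}\<close>.\<close>

lemma taylor_minimal_iff_private:
  fixes u :: "nat \<Rightarrow> ('n::finite, 'k::field) mpoly"
  assumes r: "2 \<le> r"
  shows "taylor_minimal r u \<longleftrightarrow>
    (\<forall>i\<in>{1..r}. \<exists>c. private_variable (\<lambda>i. Poly_Mapping.lookup (expo (u i))) {1..r} i c)"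
proof
  assume min: "taylor_minimal r u"
  show "\<forall>i\<in>{1..r}. \<exists>c. private_variable (\<lambda>i. Poly_Mapping.lookup (expo (u i))) {1..r} i c"
  proof
    fix i assume i: "i \<in> {1..r}"
    \<comment> \<open>\<open>xs\<close> encodes the wedge of all basis vectors. Positions start at
      \<open>0\<close> and indices at \<open>1\<close>, so omitting \<open>i\<close> means omitting
      position \<open>i - 1\<close>.\<close>
    define xs where "xs = [1..<Suc r]"
    define s where "s = i - 1"
    have xs: "distinct xs" "set xs = {1..r}" "length xs = r" "sorted_wrt (<) xs"
      by (auto simp: xs_def simp del: upt_Suc)
    have s: "s < length xs" "xs ! s = i"
      using i by (auto simp: xs(3) s_def xs_def simp del: upt_Suc)
    have ne: "{1..r} - {i} \<noteq> {}"
    proof -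
      have "(if i = 1 then 2 else 1) \<in> {1..r} - {i}"
        using r by auto
      then show ?thesis
        by blast
    qed
    have "Poly_Mapping.single xs 1 \<in> taylor_module r (r - 1)"
      using r xs by (simp add: taylor_module_def taylor_basis_def)
    moreover have "r - 1 \<in> {1..<r}"
      using r by auto
    ultimately have "taylor_diff u (Poly_Mapping.single xs 1)
        \<in> ideal_mult (ideal_gen (range Var)) (taylor_module r (r - 1 - 1))"
      using min unfolding taylor_minimal_def by blast
    then have "Poly_Mapping.lookup (taylor_diff_basis u xs) (omit s xs) \<in> ideal_gen (range Var)"
      unfolding taylor_diff_single by (rule lookup_ideal_mult)
    then have "mon_quot (mon_lcm (u ` {1..r})) (mon_lcm (u ` ({1..r} - {i})))
        \<in> ideal_gen (range Var)"
      by (simp only: lookup_taylor_diff_basis_omit[OF xs(1) s(1)] set_omit[OF xs(1) s(1)]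
          neg_one_power_mult_mem_ideal_gen_iff xs(2) s(2))
    then show "\<exists>c. private_variable (\<lambda>i. Poly_Mapping.lookup (expo (u i))) {1..r} i c"
      using mon_quot_lcm_in_maximal_ideal_iff[OF finite_atLeastAtMost i ne, of u] by simp
  qed
next
  assume priv: "\<forall>i\<in>{1..r}. \<exists>c. private_variable (\<lambda>i. Poly_Mapping.lookup (expo (u i))) {1..r} i c"
  show "taylor_minimal r u"
    unfolding taylor_minimal_def
  proof (intro ballI image_subsetI)
    fix q and x :: "nat list \<Rightarrow>\<^sub>0 ('n, 'k) mpoly"
    assume q: "q \<in> {1..<r}" and x: "x \<in> taylor_module r q"
    \<comment> \<open>Since \<open>q\<close> is positive, \<open>Suc (q - 1)\<close> is
      \<open>q\<close>.\<close>
    have "xs \<in> taylor_basis r (Suc (q - 1))" if "xs \<in> Poly_Mapping.keys x" for xs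
      using x q that by (auto simp: taylor_module_def)
    then show "taylor_diff u x \<in> ideal_mult (ideal_gen (range Var)) (taylor_module r (q - 1))"
      using priv by (intro taylor_diff_in_ideal_mult taylor_diff_basis_in_ideal_mult) auto
  qed
qed

theorem theorem1p1:
  fixes I :: "('n::finite, 'k::field) mpoly set"
    and u :: "nat \<Rightarrow> ('n, 'k) mpoly"
    and r :: nat
  assumes "monomial_ideal I"
    and "inj_on u {1..r}"
    and "minimal_monomial_generators I (u ` {1..r})"
    and "linear_quotients r u"
  shows "taylor_minimal r u \<longleftrightarrow> (\<forall>i\<in>{1..r}. card (lq_set u i) = i - 1)"
proof -
  interpret lq_exponents r "\<lambda>i. Poly_Mapping.lookup (expo (u i))" "lq_set u"
    using assms(2-4) by (rule lq_exponents_generators)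
  show ?thesis
  proof (cases "2 \<le> r")
    case True
    show ?thesis
      unfolding taylor_minimal_iff_private[OF True]
    proof (intro iffI ballI)
      fix i assume "i \<in> {1..r}"
        and "\<forall>i\<in>{1..r}. \<exists>c. private_variable (\<lambda>i. Poly_Mapping.lookup (expo (u i))) {1..r} i c"
      then show "card (lq_set u i) = i - 1"
        by (intro card_eq_if_private) simp_all
    next
      fix i assume "i \<in> {1..r}" and "\<forall>i\<in>{1..r}. card (lq_set u i) = i - 1"
      then show "\<exists>c. private_variable (\<lambda>i. Poly_Mapping.lookup (expo (u i))) {1..r} i c"
        using True by (intro private_if_card_eq) simp_all
    qed
  next
    case False
    \<comment> \<open>No differential is to be tested, as \<open>{1..<r}\<close> is empty.\<close>
    then have "taylor_minimal r u"
      by (simp add: taylor_minimal_def)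
    moreover have "card (lq_set u i) = i - 1" if i: "i \<in> {1..r}" for i
    proof -
      have "i = 1"
        using i False by simp
      \<comment> \<open>An element would be attained by an index in the empty range
        \<open>{1..<1}\<close>.\<close>
      then have "lq_set u i = {}"
        using attained[OF i] by fastforce
      then show ?thesis
        using \<open>i = 1\<close> by simp
    qed
    ultimately show ?thesis
      by blast
  qed
qed

end
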